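(* Let $\mathcal{X}\in\mathbb{R}^{s_1\times\cdots\times s_N}$ be a tensor, let $A^{(l)}=A_p^{(l)}+dA^{(l)}\in\mathbb{R}^{s_l\times R}$, $l\in\{1,\ldots,N\}$, be the current CP factor matrices, where $A_p^{(l)}$ are the factor matrices at the time the pairwise perturbation operators were formed, and let $\delta A^{(n)}=A^{(n)}_{\mathrm{new}}-A^{(n)}$ be the change of the $n$-th factor matrix performed by a regular ALS sweep. Let $\mathcal{Z}=\sum_{r=1}^R a_r^{(1)}\circ\cdots\circ a_r^{(N)}$ be the approximate CP decomposition of $\mathcal{X}$. Let $k\in\{1,\ldots,R\}$ and suppose that $$\frac{\|da_k^{(l)}\|_2}{\|a_k^{(l)}\|_2}\le \epsilon<1\quad\text{for all } l\in\{1,\ldots,N\}.$$ Then for all $m,n\in\{1,\ldots,N\}$ with $m\ne n$ (in particular for $(m,n)=(1,N)$), the pairwise perturbation algorithm with second order correction terms computes the update $\tilde H^{(m,n)}$ (with $k$-th column $\tilde h_k^{(m,n)}$) with column-wise error $$\big\|\tilde h_k^{(m,n)}-h_k^{(m,n)}\big\|_2 = O(N\epsilon)\,\|\hat{\mathcal{P}}-\hat{\mathcal{T}}\|_2\prod_{j\ne m,n}\|a_k^{(j)}\|_2+O\big((N\epsilon)^2\big)\,\|\hat{\mathcal{T}}\|_2\prod_{j\ne m,n}\|a_k^{(j)}\|_2,$$ where $\hat{\mathcal{T}}=\mathcal{X}\times_n \delta a_k^{(n)T}$, $\hat{\mathcal{P}}=\mathcal{Z}\times_n\delta a_k^{(n)T}$,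 the products are over $j\in\{1,\ldots,N\}\setminus\{m,n\}$, and $h_k^{(m,n)}$ is the $k$-th column of the exact ALS update $H^{(m,n)}$ to the MTTKRP matrix $M^{(m)}$ due to the change $\delta A^{(n)}$.
   Context: Lower-case $a_k^{(l)}, da_k^{(l)},\delta a_k^{(l)}$ denote the $k$-th columns of $A^{(l)},dA^{(l)},\delta A^{(l)}$; $\circ$ is the outer product. For a vector $v\in\mathbb{R}^{s_n}$, $\mathcal{X}\times_n v^T$ is the contraction of $\mathcal{X}$ with $v$ along mode $n$ (mode $n$ is removed; the remaining modes keep their original labels). Spectral norm of a tensor $\mathcal{T}$ of order $M$: $\|\mathcal{T}\|_2=\max \|\mathcal{T}\times_2 x^{(2)T}\cdots\times_M x^{(M)T}\|_2$ over unit vectors $x^{(2)},\ldots,x^{(M)}$ (this is invariant under reordering of modes). CP-ALS: a regular update of the $n$-th factor is $A^{(n)}_{\mathrm{new}}=M^{(n)}\Gamma^{(n)\dagger}$, where $M^{(n)}$ (the MTTKRP) has $k$-th column equal to the contraction of $\mathcal{X}$ with $a_k^{(j)}$ along every mode $j\neq n$, $\Gamma^{(n)}$ is the Hadamard product of $A^{(j)T}A^{(j)}$ over $j\ne n$, and $\dagger$ is the pseudoinverse. The exact ALS update to column $k$ of $M^{(m)}$ due to $\delta A^{(n)}$ is $h_k^{(m,n)}=\hat{\mathcal{T}}$ contracted with $a_k^{(j)}$ along every mode $j\notin\{m,n\}$. The update computed by pairwise perturbation with second order corrections (in which the terms containing $\delta a_k^{(n)}$ and one perturbation $da_k^{(i)}$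 are supplied by replacing $\mathcal{X}$ with $\mathcal{Z}$) is $$\tilde h_k^{(m,n)}=\Big(\hat{\mathcal{T}}\ \text{contracted with } a_k^{(j)}-da_k^{(j)} \text{ along every mode } j\notin\{m,n\}\Big)+\sum_{i\notin\{m,n\}}\Big(\hat{\mathcal{P}}\ \text{contracted with } da_k^{(i)}\text{ along mode } i \text{ and with } a_k^{(j)}\text{ along every mode } j\notin\{m,n,i\}\Big).$$ The symbols $O(N\epsilon)$ and $O((N\epsilon)^2)$ are meant to leading order as $N\epsilon\to0$: there are absolute constants $C,c>0$ (independent of $N$, the dimensions, the tensor and the factors) such that whenever $N\epsilon\le c$ the left-hand side is at most the right-hand side with $O(N\epsilon)$ and $O((N\epsilon)^2)$ replaced by $CN\epsilon$ and $C(N\epsilon)^2$. *)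

theory Defs
  imports "HOL-Library.FuncSet" "HOL-Analysis.L2_Norm" "Jordan_Normal_Form.Matrix"
begin

(* A real tensor whose modes are labelled by a finite set I of naturals, mode l having
   dimension s l, is a function on the multi-indices in PiE I (\<lambda>l. {..<s l}); its values at
   other arguments are never used.  An order-N tensor has the mode set {..<N}, so modes are
   numbered from 0. *)

type_synonym tensor = "(nat \<Rightarrow> nat) \<Rightarrow> real"

definition l2norm :: "real vec \<Rightarrow> real" where
  "l2norm v = L2_set (\<lambda>i. v $ i) {..<dim_vec v}"

definition contract :: "tensor \<Rightarrow> nat \<Rightarrow> real vec \<Rightarrow> tensor" where
  "contract X n v = (\<lambda>i. \<Sum>j<dim_vec v. X (i(n := j)) * v $ j)"

(* Contraction with w j along every mode j of the finite set J, one mode at a time; contractions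
   along different modes commute (see contract_commute), so the order is immaterial. *)

definition contract_modes :: "nat set \<Rightarrow> (nat \<Rightarrow> real vec) \<Rightarrow> tensor \<Rightarrow> tensor" where
  "contract_modes J w X = fold (\<lambda>j Y. contract Y j (w j)) (sorted_list_of_set J) X"

(* A tensor whose only remaining mode is j, read as a vector. *)

definition mode_vec :: "(nat \<Rightarrow> nat) \<Rightarrow> nat \<Rightarrow> tensor \<Rightarrow> real vec" where
  "mode_vec s j T = vec (s j) (\<lambda>i. T (\<lambda>_\<in>{j}. i))"

(* The spectral norm of a tensor with nonempty mode set I.  The uncontracted mode is the first
   one, Min I.  The set of values is bounded and (by compactness) the supremum is attained when
   all dimensions are positive. *)

definition spectral_norm :: "(nat \<Rightarrow> nat) \<Rightarrow> nat set \<Rightarrow> tensor \<Rightarrow> real" where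
  "spectral_norm s I T =
    (SUP x \<in> {x. \<forall>j\<in>I - {Min I}. x j \<in> carrier_vec (s j) \<and> l2norm (x j) = 1}.
       l2norm (mode_vec s (Min I) (contract_modes (I - {Min I}) x T)))"

definition outer_product :: "nat \<Rightarrow> (nat \<Rightarrow> real vec) \<Rightarrow> tensor" where
  "outer_product N v = (\<lambda>i. \<Prod>l<N. v l $ i l)"

definition cp_tensor :: "nat \<Rightarrow> nat \<Rightarrow> (nat \<Rightarrow> real mat) \<Rightarrow> tensor" where
  "cp_tensor N R A = (\<lambda>i. \<Sum>r<R. outer_product N (\<lambda>l. col (A l) r) i)"

(* The Moore-Penrose inverse, by the four Penrose conditions. *)

definition is_pinv :: "real mat \<Rightarrow> real mat \<Rightarrow> bool" where
  "is_pinv G P \<longleftrightarrow> P \<in> carrier_mat (dim_col G) (dim_row G) \<and>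
     G * P * G = G \<and> P * G * P = P \<and>
     transpose_mat (G * P) = G * P \<and> transpose_mat (P * G) = P * G"

definition pinv :: "real mat \<Rightarrow> real mat" where
  "pinv G = (THE P. is_pinv G P)"

definition mttkrp ::
  "nat \<Rightarrow> (nat \<Rightarrow> nat) \<Rightarrow> nat \<Rightarrow> tensor \<Rightarrow> (nat \<Rightarrow> real mat) \<Rightarrow> nat \<Rightarrow> real mat" where
  "mttkrp N s R X A n = mat_of_cols (s n)
     (map (\<lambda>k. mode_vec s n (contract_modes ({..<N} - {n}) (\<lambda>j. col (A j) k) X)) [0..<R])"

definition gram_hadamard :: "nat \<Rightarrow> nat \<Rightarrow> (nat \<Rightarrow> real mat) \<Rightarrow> nat \<Rightarrow> real mat" where
  "gram_hadamard N R A n =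
     mat R R (\<lambda>pq. \<Prod>j\<in>{..<N} - {n}. (transpose_mat (A j) * A j) $$ pq)"

definition als_update ::
  "nat \<Rightarrow> (nat \<Rightarrow> nat) \<Rightarrow> nat \<Rightarrow> tensor \<Rightarrow> nat \<Rightarrow> (nat \<Rightarrow> real mat) \<Rightarrow> (nat \<Rightarrow> real mat)" where
  "als_update N s R X n A = A(n := mttkrp N s R X A n * pinv (gram_hadamard N R A n))"

(* Regular ALS updates of the modes in the list ns, in this order, each one using the results of
   the previous ones; a full sweep is the case that ns enumerates all modes. *)

definition als_sweep ::
  "nat \<Rightarrow> (nat \<Rightarrow> nat) \<Rightarrow> nat \<Rightarrow> tensor \<Rightarrow> nat list \<Rightarrow> (nat \<Rightarrow> real mat) \<Rightarrow> (nat \<Rightarrow> real mat)" where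
  "als_sweep N s R X ns A = fold (als_update N s R X) ns A"

(* Below, a j, da j are the k-th columns of the factor and of its perturbation, and
   That, Phat are the contractions of X and of the CP approximation with the k-th column of
   the change of the n-th factor. *)

definition exact_update_col ::
  "nat \<Rightarrow> (nat \<Rightarrow> nat) \<Rightarrow> tensor \<Rightarrow> (nat \<Rightarrow> real vec) \<Rightarrow> nat \<Rightarrow> nat \<Rightarrow> real vec" where
  "exact_update_col N s That a m n = mode_vec s m (contract_modes ({..<N} - {m, n}) a That)"

definition pp_update_col ::
  "nat \<Rightarrow> (nat \<Rightarrow> nat) \<Rightarrow> tensor \<Rightarrow> tensor \<Rightarrow> (nat \<Rightarrow> real vec) \<Rightarrow> (nat \<Rightarrow> real vec)
     \<Rightarrow> nat \<Rightarrow> nat \<Rightarrow> real vec" where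
  "pp_update_col N s That Phat a da m n = mode_vec s m (\<lambda>idx.
      contract_modes ({..<N} - {m, n}) (\<lambda>j. a j - da j) That idx +
      (\<Sum>i\<in>{..<N} - {m, n}.
         contract_modes ({..<N} - {m, n, i}) a (contract Phat i (da i)) idx))"

lemma contract_commute:
  assumes "m \<noteq> n"
  shows "contract (contract X m v) n w = contract (contract X n w) m v"
proof
  fix i
  have "contract (contract X m v) n w i =
    (\<Sum>b<dim_vec w. \<Sum>a<dim_vec v. X (i(n := b, m := a)) * v $ a * w $ b)"
    by (simp add: contract_def sum_distrib_right)
  also have "\<dots> = (\<Sum>a<dim_vec v. \<Sum>b<dim_vec w. X (i(m := a, n := b)) * w $ b * v $ a)"
    by (subst sum.swap) (use assms in \<open>simp add: fun_upd_twist mult_ac\<close>)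
  also have "\<dots> = contract (contract X n w) m v i"
    by (simp add: contract_def sum_distrib_right)
  finally show "contract (contract X m v) n w i = contract (contract X n w) m v i" .
qed

lemma contract_modes_remove:
  assumes "finite J" "n \<in> J"
  shows "contract_modes J w X = contract_modes (J - {n}) w (contract X n (w n))"
proof -
  let ?f = "\<lambda>j Y. contract Y j (w j)"
  have "?f x \<circ> ?f y = ?f y \<circ> ?f x" for x y
    by (cases "x = y") (auto simp: contract_commute)
  then have "fold ?f (sorted_list_of_set J) =
      fold ?f (remove1 n (sorted_list_of_set J)) \<circ> ?f n"
    by (intro fold_remove1_split) (use assms in auto)
  then show ?thesis
    using assms by (simp add: contract_modes_def sorted_list_of_set_remove)
qed

lemma contract_modes_cong:
  assumes "finite J" "\<And>j. j \<in> J \<Longrightarrow> w j = w' j"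
  shows "contract_modes J w X = contract_modes J w' X"
  unfolding contract_modes_def using assms by (intro fold_cong) auto

lemma contract_modes_diff:
  "contract_modes J w (\<lambda>i. X i - Y i) = (\<lambda>i. contract_modes J w X i - contract_modes J w Y i)"
proof -
  have "fold (\<lambda>j Y. contract Y j (w j)) js (\<lambda>i. X i - Y i) =
    (\<lambda>i. fold (\<lambda>j Y. contract Y j (w j)) js X i - fold (\<lambda>j Y. contract Y j (w j)) js Y i)"
    for js :: "nat list"
  proof (induction js arbitrary: X Y)
    case (Cons j js)
    have "contract (\<lambda>i. X i - Y i) j (w j) =
        (\<lambda>i. contract X j (w j) i - contract Y j (w j) i)"
      by (simp add: contract_def left_diff_distrib sum_subtractf)
    then show ?case
      using Cons[of "contract X j (w j)" "contract Y j (w j)"] by simp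
  qed simp
  then show ?thesis
    unfolding contract_modes_def .
qed

(* exact_update_col is the change of the column of the m-th MTTKRP matrix. *)

lemma exact_update_col_mttkrp:
  assumes "m < N" "n < N" "m \<noteq> n" "k < R"
    and A: "A n \<in> carrier_mat (s n) R" and D: "D \<in> carrier_mat (s n) R"
  shows "col (mttkrp N s R X (A(n := A n + D)) m) k - col (mttkrp N s R X A m) k =
    exact_update_col N s (contract X n (col D k)) (\<lambda>j. col (A j) k) m n"
proof -
  let ?A' = "A(n := A n + D)" and ?J = "{..<N} - {m}" and ?J' = "{..<N} - {m, n}"
  have J: "finite ?J" "n \<in> ?J" "?J - {n} = ?J'"
    using assms by auto
  have mcol: "col (mttkrp N s R X B m) k =
      mode_vec s m (contract_modes ?J (\<lambda>j. col (B j) k) X)" for B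
    unfolding mttkrp_def using \<open>k < R\<close>
    by (subst col_mat_of_cols) (auto simp: mode_vec_def)
  have step: "contract_modes ?J (\<lambda>j. col (B j) k) X =
      contract_modes ?J' (\<lambda>j. col (B j) k) (contract X n (col (B n) k))" for B
    using contract_modes_remove[OF J(1,2)] J(3) by simp
  have 1: "contract_modes ?J' (\<lambda>j. col (?A' j) k) = contract_modes ?J' (\<lambda>j. col (A j) k)"
    by (rule ext, rule contract_modes_cong) auto
  have 2: "(\<lambda>i. contract X n (col (A n + D) k) i - contract X n (col (A n) k) i) =
      contract X n (col D k)"
    using A D \<open>k < R\<close>
    by (auto simp: contract_def fun_eq_iff sum_subtractf[symmetric] algebra_simps intro!: sum.cong)
  have 3: "contract_modes ?J' (\<lambda>j. col (A j) k) (contract X n (col D k)) =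
      (\<lambda>i. contract_modes ?J' (\<lambda>j. col (A j) k) (contract X n (col (A n + D) k)) i
         - contract_modes ?J' (\<lambda>j. col (A j) k) (contract X n (col (A n) k)) i)"
    by (simp only: 2[symmetric] contract_modes_diff)
  show ?thesis
    unfolding mcol step 1 exact_update_col_def 3
    by (intro eq_vecI) (auto simp: mode_vec_def)
qed

end

theory Submission
  imports Defs
begin

text \<open>
  Pairing the error vector with the unit vector in its own direction turns both updates into values
  of multilinear forms \<open>F\<close>, for which \<open>\<bar>F w\<bar>\<close> is at most the spectral norm times the product of the
  norms of the arguments; this bound does not single out a mode, although the definition of the
  spectral norm does.
  Writing \<open>F\<^sub>i\<close> for \<open>F\<close> at \<open>a\<close> with the \<open>i\<close>-th argument replaced by \<open>da\<^sub>i\<close>, the error is the sum of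
  the first order terms \<open>F\<^sub>i\<close> for the tensor \<open>Phat - That\<close>, and of the remainder
  \<open>F(a - da) - F(a) + \<Sum>\<^sub>i F\<^sub>i\<close> for \<open>That\<close>. Changing one argument at a time expresses the remainder by
  at most \<open>N\<^sup>2\<close> values of \<open>F\<close> having two arguments \<open>da\<close>, each of relative
  size at most \<open>\<epsilon>\<^sup>2 (1 + \<epsilon>)\<^sup>N\<close>, and \<open>(1 + \<epsilon>)\<^sup>N \<le> e\<close> as soon as \<open>N \<epsilon> \<le> 1\<close>.
\<close>

section \<open>The Euclidean norm\<close>

lemma l2norm_nonneg [simp]: "0 \<le> l2norm v"
  by (simp add: l2norm_def)

lemma l2norm_eq_0_iff: "l2norm v = 0 \<longleftrightarrow> v = 0\<^sub>v (dim_vec v)"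
  by (auto simp: l2norm_def L2_set_eq_0_iff vec_eq_iff)

lemma l2norm_smult: "l2norm (c \<cdot>\<^sub>v v) = \<bar>c\<bar> * l2norm v"
proof -
  have "l2norm (c \<cdot>\<^sub>v v) = sqrt (c\<^sup>2 * (\<Sum>i<dim_vec v. (v $ i)\<^sup>2))"
    by (simp add: l2norm_def L2_set_def power_mult_distrib sum_distrib_left)
  then show ?thesis
    by (simp add: l2norm_def L2_set_def real_sqrt_mult)
qed

lemma l2norm_diff_le:
  assumes "dim_vec v = dim_vec w"
  shows "l2norm (v - w) \<le> l2norm v + l2norm w"
proof -
  have "l2norm (v - w) = L2_set (\<lambda>i. v $ i + - w $ i) {..<dim_vec w}"
    unfolding l2norm_def by (intro L2_set_cong) auto
  also have "\<dots> \<le> L2_set (\<lambda>i. v $ i) {..<dim_vec w} + L2_set (\<lambda>i. - w $ i) {..<dim_vec w}"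
    by (rule L2_set_triangle_ineq)
  finally show ?thesis
    using assms by (simp add: l2norm_def L2_set_def)
qed

lemma abs_index_le_l2norm: "i < dim_vec v \<Longrightarrow> \<bar>v $ i\<bar> \<le> l2norm v"
  using member_le_L2_set[of "{..<dim_vec v}" i "\<lambda>i. \<bar>v $ i\<bar>"]
  by (simp add: l2norm_def L2_set_def)

text \<open>For the zero vector any unit vector serves as direction; \<open>0 < d\<close> supplies
  the first basis vector. Hence no case split on vanishing vectors is needed later.\<close>

lemma unit_direction:
  assumes "v \<in> carrier_vec d" "0 < d"
  obtains u where "u \<in> carrier_vec d" "l2norm u = 1" "v = l2norm v \<cdot>\<^sub>v u"
proof (cases "l2norm v = 0")
  case True
  have "l2norm (unit_vec d 0 :: real vec) = sqrt (\<Sum>i<d. if i = 0 then 1 else 0)"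
    unfolding l2norm_def L2_set_def by (intro arg_cong[of _ _ sqrt] sum.cong) (auto simp: unit_vec_def)
  also have "\<dots> = 1"
    using \<open>0 < d\<close> by (subst sum.delta) auto
  finally show ?thesis
    using that[of "unit_vec d 0"] True assms by (fastforce simp: l2norm_eq_0_iff vec_eq_iff)
next
  case False
  then show ?thesis
    using that[of "(1 / l2norm v) \<cdot>\<^sub>v v"] assms
    by (auto simp: l2norm_smult smult_smult_assoc)
qed

lemma scalar_prod_le_l2norm:
  assumes "v \<in> carrier_vec d" "w \<in> carrier_vec d"
  shows "\<bar>v \<bullet> w\<bar> \<le> l2norm v * l2norm w"
proof -
  have "\<bar>v \<bullet> w\<bar> \<le> (\<Sum>i<d. \<bar>v $ i\<bar> * \<bar>w $ i\<bar>)"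
    using assms sum_abs[of "\<lambda>i. v $ i * w $ i" "{..<d}"]
    by (simp add: scalar_prod_def abs_mult lessThan_atLeast0)
  also have "\<dots> \<le> l2norm v * l2norm w"
    using assms L2_set_mult_ineq[of "\<lambda>i. v $ i" "\<lambda>i. w $ i" "{..<d}"] by (simp add: l2norm_def)
  finally show ?thesis .
qed

lemma scalar_prod_self: "v \<bullet> v = (l2norm v)\<^sup>2"
  by (simp add: l2norm_def L2_set_def scalar_prod_def sum_nonneg lessThan_atLeast0 power2_eq_square)

section \<open>Contraction along several modes\<close>

lemma contract_add:
  "contract (\<lambda>i. X i + Y i) n v = (\<lambda>i. contract X n v i + contract Y n v i)"
  by (simp add: contract_def distrib_right sum.distrib)

lemma contract_diff:
  "contract (\<lambda>i. X i - Y i) n v = (\<lambda>i. contract X n v i - contract Y n v i)"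
  by (simp add: contract_def left_diff_distrib sum_subtractf)

lemma contract_sum:
  "contract (\<lambda>i. \<Sum>l\<in>L. X l i) n v = (\<lambda>i. \<Sum>l\<in>L. contract (X l) n v i)"
proof
  fix i
  show "contract (\<lambda>i. \<Sum>l\<in>L. X l i) n v i = (\<Sum>l\<in>L. contract (X l) n v i)"
    unfolding contract_def sum_distrib_right by (rule sum.swap)
qed

lemma contract_diff_vec:
  assumes "dim_vec v = dim_vec w"
  shows "contract X n (v - w) = (\<lambda>i. contract X n v i - contract X n w i)"
  using assms by (simp add: contract_def right_diff_distrib sum_subtractf)

lemma contract_modes_contract:
  assumes "n \<notin> J"
  shows "contract_modes J w (contract X n v) = contract (contract_modes J w X) n v"
proof (cases "finite J")
  case True
  have "fold (\<lambda>j Y. contract Y j (w j)) js (contract X n v) =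
      contract (fold (\<lambda>j Y. contract Y j (w j)) js X) n v" if "n \<notin> set js" for js
    using that
  proof (induction js arbitrary: X)
    case (Cons j js)
    then show ?case
      using contract_commute[of n j X v "w j"] by simp
  qed simp
  then show ?thesis
    using assms True by (simp add: contract_modes_def)
\<comment> \<open>For infinite \<open>J\<close> the list \<open>sorted_list_of_set J\<close> is
  empty, so both sides are \<open>contract X n v\<close>.\<close>
qed (simp add: contract_modes_def)

lemma contract_modes_remove_last:
  assumes "finite J" "n \<in> J"
  shows "contract_modes J w X = contract (contract_modes (J - {n}) w X) n (w n)"
  using contract_modes_remove[OF assms] by (simp add: contract_modes_contract)

text \<open>Contracting mode \<open>n\<close> last confines the dependence on the
  \<open>n\<close>-th argument to one outer \<open>contract\<close>, so linearity in each argument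
  reduces to linearity of a single contraction.\<close>

lemma contract_modes_fun_upd:
  assumes "finite J" "n \<in> J"
  shows "contract_modes J (w(n := v)) X = contract (contract_modes (J - {n}) w X) n v"
  using contract_modes_remove_last[OF assms, of "w(n := v)"]
    contract_modes_cong[of "J - {n}" "w(n := v)" w X] assms by simp

lemma contract_modes_diff_vec:
  assumes "finite J" "n \<in> J" "dim_vec v = dim_vec v'"
  shows "contract_modes J (w(n := v - v')) X =
    (\<lambda>i. contract_modes J (w(n := v)) X i - contract_modes J (w(n := v')) X i)"
  using assms by (simp add: contract_modes_fun_upd contract_diff_vec)

lemma contract_modes_smult_vec:
  assumes "finite J"
  shows "contract_modes J (\<lambda>j. c j \<cdot>\<^sub>v x j) X = (\<lambda>i. (\<Prod>j\<in>J. c j) * contract_modes J x X i)"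
  using assms
proof (induction J)
  case empty
  then show ?case by (simp add: contract_modes_def)
next
  case (insert n J)
  then show ?case
    by (simp add: contract_modes_remove_last[of "insert n J" n] contract_def sum_distrib_left mult_ac)
qed

text \<open>Entries of a unit vector have absolute value at most 1. The bound is crude, but it does
  not depend on \<open>x\<close>.\<close>

lemma contract_modes_abs_le:
  assumes "finite J" "\<And>j. j \<in> J \<Longrightarrow> x j \<in> carrier_vec (s j) \<and> l2norm (x j) = 1"
  shows "\<bar>contract_modes J x X i\<bar> \<le> contract_modes J (\<lambda>j. vec (s j) (\<lambda>_. 1)) (\<lambda>i. \<bar>X i\<bar>) i"
  using assms
proof (induction J arbitrary: i)
  case empty
  then show ?case by (simp add: contract_modes_def)
next
  case (insert n J)
  let ?Y = "contract_modes J (\<lambda>j. vec (s j) (\<lambda>_. 1)) (\<lambda>i. \<bar>X i\<bar>)"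
  have "\<bar>contract_modes J x X (i(n := j)) * x n $ j\<bar> \<le> ?Y (i(n := j))" if "j < s n" for j
  proof -
    have "\<bar>x n $ j\<bar> \<le> 1"
      using abs_index_le_l2norm[of j "x n"] insert.prems[of n] that by auto
    then show ?thesis
      using mult_mono'[of "\<bar>contract_modes J x X (i(n := j))\<bar>" "?Y (i(n := j))" "\<bar>x n $ j\<bar>" 1]
        insert.IH[of "i(n := j)"] insert.prems by (simp add: abs_mult)
  qed
  then have "\<bar>\<Sum>j<s n. contract_modes J x X (i(n := j)) * x n $ j\<bar> \<le> (\<Sum>j<s n. ?Y (i(n := j)))"
    by (intro order_trans[OF sum_abs] sum_mono) auto
  moreover have "dim_vec (x n) = s n"
    using insert.prems[of n] by auto
  ultimately show ?case
    using insert.hyps by (simp add: contract_modes_remove_last[of "insert n J" n] contract_def)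
qed

text \<open>The multi-index \<open>\<lambda>_. undefined\<close> is the only one over the empty set of modes.\<close>

lemma scalar_prod_mode_vec:
  assumes "u \<in> carrier_vec (s m)"
  shows "mode_vec s m T \<bullet> u = contract T m u (\<lambda>_. undefined)"
proof -
  have "(\<lambda>_\<in>{m}. j) = (\<lambda>_. undefined)(m := j)" for j :: nat
    by auto
  then show ?thesis
    using assms by (simp add: scalar_prod_def mode_vec_def contract_def lessThan_atLeast0)
qed

section \<open>The spectral norm bounds the multilinear form\<close>

text \<open>A real supremum dominates its members only over a set that is bounded above. Such a
  bound comes from replacing the Euclidean norm by the sum of absolute entries and bounding each
  entry uniformly in \<open>x\<close>.\<close>

lemma mode_vec_le_spectral_norm:
  assumes "finite I" "\<And>j. j \<in> I - {Min I} \<Longrightarrow> x j \<in> carrier_vec (s j) \<and> l2norm (x j) = 1"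
  shows "l2norm (mode_vec s (Min I) (contract_modes (I - {Min I}) x T)) \<le> spectral_norm s I T"
  unfolding spectral_norm_def
proof (rule cSUP_upper)
  let ?B = "\<lambda>i. contract_modes (I - {Min I}) (\<lambda>j. vec (s j) (\<lambda>_. 1)) (\<lambda>i. \<bar>T i\<bar>) (\<lambda>_\<in>{Min I}. i)"
  show "bdd_above ((\<lambda>x. l2norm (mode_vec s (Min I) (contract_modes (I - {Min I}) x T))) `
      {x. \<forall>j\<in>I - {Min I}. x j \<in> carrier_vec (s j) \<and> l2norm (x j) = 1})"
  proof (rule bdd_aboveI2)
    fix x assume x: "x \<in> {x. \<forall>j\<in>I - {Min I}. x j \<in> carrier_vec (s j) \<and> l2norm (x j) = 1}"
    have "l2norm (mode_vec s (Min I) (contract_modes (I - {Min I}) x T)) \<le>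
      (\<Sum>i<s (Min I). \<bar>contract_modes (I - {Min I}) x T (\<lambda>_\<in>{Min I}. i)\<bar>)"
      unfolding l2norm_def
      by (rule order_trans[OF L2_set_le_sum_abs]) (simp add: mode_vec_def)
    also have "\<dots> \<le> (\<Sum>i<s (Min I). ?B i)"
      using x assms(1) by (intro sum_mono contract_modes_abs_le) auto
    finally show "l2norm (mode_vec s (Min I) (contract_modes (I - {Min I}) x T)) \<le>
      (\<Sum>i<s (Min I). ?B i)" .
  qed
qed (use assms in auto)

text \<open>Positive dimensions guarantee that unit vectors exist, so the supremum lies above at
  least one norm.\<close>

lemma spectral_norm_nonneg:
  assumes "finite I" "\<And>j. j \<in> I \<Longrightarrow> 0 < s j"
  shows "0 \<le> spectral_norm s I T"
proof -
  have "\<exists>u. u \<in> carrier_vec (s j) \<and> l2norm u = 1" if "j \<in> I" for j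
    using unit_direction[of "0\<^sub>v (s j)" "s j"] assms(2)[OF that] by auto
  then obtain x where "\<And>j. j \<in> I \<Longrightarrow> x j \<in> carrier_vec (s j) \<and> l2norm (x j) = 1"
    by metis
  then show ?thesis
    using mode_vec_le_spectral_norm[of I x s T] assms(1)
    by (meson DiffE l2norm_nonneg order_trans)
qed

text \<open>Multilinearity pulls out the norms and leaves unit arguments. At these the form is the
  inner product of the vector left along mode \<open>Min I\<close> with a unit vector, and
  Cauchy-Schwarz applies. The result treats all modes alike.\<close>

lemma contract_modes_le_spectral_norm:
  assumes "finite I" "I \<noteq> {}" and s: "\<And>j. j \<in> I \<Longrightarrow> 0 < s j"
    and w: "\<And>j. j \<in> I \<Longrightarrow> w j \<in> carrier_vec (s j)"
  shows "\<bar>contract_modes I w T (\<lambda>_. undefined)\<bar> \<le> spectral_norm s I T * (\<Prod>j\<in>I. l2norm (w j))"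
proof -
  define q where "q = Min I"
  have q: "q \<in> I"
    using assms by (simp add: q_def)
  have "\<exists>u. u \<in> carrier_vec (s j) \<and> l2norm u = 1 \<and> w j = l2norm (w j) \<cdot>\<^sub>v u" if "j \<in> I" for j
    using unit_direction[OF w[OF that] s[OF that]] by metis
  then obtain x where
    x: "\<And>j. j \<in> I \<Longrightarrow> x j \<in> carrier_vec (s j) \<and> l2norm (x j) = 1 \<and> w j = l2norm (w j) \<cdot>\<^sub>v x j"
    by metis
  have "contract_modes I w T = contract_modes I (\<lambda>j. l2norm (w j) \<cdot>\<^sub>v x j) T"
    using x assms(1) by (intro contract_modes_cong) auto
  also have "\<dots> = (\<lambda>i. (\<Prod>j\<in>I. l2norm (w j)) * contract_modes I x T i)"
    by (rule contract_modes_smult_vec[OF assms(1)])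
  finally have scale: "contract_modes I w T = (\<lambda>i. (\<Prod>j\<in>I. l2norm (w j)) * contract_modes I x T i)" .
  let ?v = "mode_vec s q (contract_modes (I - {q}) x T)"
  have "\<bar>contract_modes I x T (\<lambda>_. undefined)\<bar> = \<bar>?v \<bullet> x q\<bar>"
    using scalar_prod_mode_vec[of "x q" s q] x[OF q] contract_modes_remove_last[OF assms(1) q]
    by simp
  also have "\<dots> \<le> l2norm ?v"
    using scalar_prod_le_l2norm[of ?v "s q" "x q"] x[OF q] by (simp add: mode_vec_def)
  also have "\<dots> \<le> spectral_norm s I T"
    unfolding q_def using x assms(1) by (intro mode_vec_le_spectral_norm) auto
  finally show ?thesis
    unfolding scale abs_mult mult.commute[of "spectral_norm s I T"]
    by (simp add: prod_nonneg mult_left_mono)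
qed

section \<open>Second order expansion of a multilinear form\<close>

text \<open>Interpolates between \<open>a\<close> and \<open>a - d\<close>: as \<open>K\<close>
  grows from the empty set to \<open>J\<close>, the arguments change one at a time.\<close>

definition perturb :: "(nat \<Rightarrow> real vec) \<Rightarrow> (nat \<Rightarrow> real vec) \<Rightarrow> nat set \<Rightarrow> nat \<Rightarrow> real vec" where
  "perturb a d K j = (if j \<in> K then a j - d j else a j)"

text \<open>Abstracts the form obtained by fixing a unit vector in mode \<open>m\<close>, with
  \<open>S\<close> the spectral norm. It is instantiated for both \<open>T\<close> and
  \<open>P - T\<close>.\<close>

locale bounded_multilinear_form =
  fixes J :: "nat set" and s :: "nat \<Rightarrow> nat" and F :: "(nat \<Rightarrow> real vec) \<Rightarrow> real" and S :: real
  assumes finite_J: "finite J"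
    and S_nonneg: "0 \<le> S"
    and F_diff: "\<lbrakk>j \<in> J; v \<in> carrier_vec (s j); v' \<in> carrier_vec (s j)\<rbrakk> \<Longrightarrow>
      F (w(j := v - v')) = F (w(j := v)) - F (w(j := v'))"
    and F_bound: "(\<And>j. j \<in> J \<Longrightarrow> w j \<in> carrier_vec (s j)) \<Longrightarrow>
      \<bar>F w\<bar> \<le> S * (\<Prod>j\<in>J. l2norm (w j))"
begin

text \<open>The power of \<open>1 + \<epsilon>\<close> pays for arguments \<open>a j - d j\<close>,
  whose norm is at most \<open>1 + \<epsilon>\<close> times that of \<open>a j\<close>.\<close>

definition majorant :: "(nat \<Rightarrow> real vec) \<Rightarrow> real \<Rightarrow> real" where
  "majorant a \<epsilon> = S * (1 + \<epsilon>) ^ card J * (\<Prod>j\<in>J. l2norm (a j))"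

context
  fixes a d :: "nat \<Rightarrow> real vec" and \<epsilon> :: real
  assumes a: "\<And>j. j \<in> J \<Longrightarrow> a j \<in> carrier_vec (s j)"
    and d: "\<And>j. j \<in> J \<Longrightarrow> d j \<in> carrier_vec (s j)"
    and d_le: "\<And>j. j \<in> J \<Longrightarrow> l2norm (d j) \<le> \<epsilon> * l2norm (a j)"
    and eps: "0 \<le> \<epsilon>"
begin

lemma majorant_nonneg: "0 \<le> majorant a \<epsilon>"
  using S_nonneg eps by (simp add: majorant_def prod_nonneg)

lemma first_order_le:
  assumes "i \<in> J"
  shows "\<bar>F (a(i := d i))\<bar> \<le> \<epsilon> * S * (\<Prod>j\<in>J. l2norm (a j))"
proof -
  have "\<bar>F (a(i := d i))\<bar> \<le> S * (\<Prod>j\<in>J. l2norm ((a(i := d i)) j))"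
    by (rule F_bound) (use a d in auto)
  also have "\<dots> = S * (l2norm (d i) * (\<Prod>j\<in>J - {i}. l2norm (a j)))"
    using assms finite_J by (simp add: prod.remove)
  also have "\<dots> \<le> S * ((\<epsilon> * l2norm (a i)) * (\<Prod>j\<in>J - {i}. l2norm (a j)))"
    using S_nonneg d_le[OF assms] by (intro mult_left_mono mult_right_mono prod_nonneg) auto
  finally show ?thesis
    using assms finite_J by (simp add: prod.remove mult_ac)
qed

text \<open>The arguments at \<open>i\<close> and \<open>l\<close> contribute a factor
  \<open>\<epsilon>\<close> each; every other one contributes at most \<open>1 + \<epsilon>\<close>,
  whether or not it lies in \<open>K\<close>.\<close>

lemma two_perturbations_le:
  assumes "i \<in> J" "l \<in> J" "i \<noteq> l"
  shows "\<bar>F ((perturb a d K)(i := d i, l := d l))\<bar> \<le> \<epsilon>\<^sup>2 * majorant a \<epsilon>"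
proof -
  let ?w = "(perturb a d K)(i := d i, l := d l)" and ?A = "\<lambda>B. \<Prod>j\<in>B. l2norm (a j)"
  have p: "l2norm (perturb a d K j) \<le> (1 + \<epsilon>) * l2norm (a j)" if "j \<in> J" for j
  proof (cases "j \<in> K")
    case True
    have "l2norm (a j - d j) \<le> l2norm (a j) + l2norm (d j)"
      using a[OF that] d[OF that] by (intro l2norm_diff_le) auto
    then show ?thesis
      using d_le[OF that] True by (simp add: perturb_def algebra_simps)
  next
    case False
    then show ?thesis
      using eps by (simp add: perturb_def algebra_simps)
  qed
  let ?e = "\<lambda>j. (if j = i \<or> j = l then \<epsilon> else 1 + \<epsilon>)"
  have "\<bar>F ?w\<bar> \<le> S * (\<Prod>j\<in>J. l2norm (?w j))"
    by (rule F_bound) (use a d in \<open>auto simp: perturb_def\<close>)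
  also have "\<dots> \<le> S * (\<Prod>j\<in>J. ?e j * l2norm (a j))"
    using S_nonneg p d_le by (intro mult_left_mono prod_mono) auto
  also have "\<dots> = S * (\<Prod>j\<in>J. ?e j) * ?A J"
    by (simp add: prod.distrib)
  also have "(\<Prod>j\<in>J. ?e j) = \<epsilon>\<^sup>2 * (\<Prod>j\<in>J - {i} - {l}. ?e j)"
    using assms finite_J by (simp add: prod.remove[of J i] prod.remove[of "J - {i}" l] power2_eq_square)
  also have "(\<Prod>j\<in>J - {i} - {l}. ?e j) = (1 + \<epsilon>) ^ card (J - {i} - {l})"
    by simp
  \<comment> \<open>As \<open>1 + \<epsilon>\<close> is at least 1, the exponent may be raised to
    \<open>card J\<close>, which makes the bound independent of \<open>i\<close> and
    \<open>l\<close>.\<close>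
  also have "S * (\<epsilon>\<^sup>2 * (1 + \<epsilon>) ^ card (J - {i} - {l})) * ?A J \<le> S * (\<epsilon>\<^sup>2 * (1 + \<epsilon>) ^ card J) * ?A J"
    using S_nonneg eps finite_J
    by (intro mult_left_mono mult_right_mono power_increasing prod_nonneg card_mono) auto
  finally show ?thesis
    by (simp add: majorant_def mult_ac del: fun_upd_apply)
qed

text \<open>Each index \<open>l\<close> added to \<open>K\<close> changes the value by one term with
  \<open>d\<close> in both places \<open>i\<close> and \<open>l\<close>; there are
  \<open>card K\<close> such changes.\<close>

lemma one_perturbation_diff_le:
  assumes "finite K" "K \<subseteq> J" "i \<in> J" "i \<notin> K"
  shows "\<bar>F ((perturb a d K)(i := d i)) - F (a(i := d i))\<bar> \<le> real (card K) * \<epsilon>\<^sup>2 * majorant a \<epsilon>"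
  using assms
proof (induction K)
  case empty
  then show ?case
    by (simp add: perturb_def)
next
  case (insert l K)
  let ?w = "(perturb a d K)(i := d i)"
  have l: "l \<in> J" "l \<noteq> i"
    using insert by auto
  \<comment> \<open>The second equation uses \<open>l \<notin> K\<close>: the argument at
    \<open>l\<close> is still \<open>a l\<close>.\<close>
  have upd: "(perturb a d (insert l K))(i := d i) = ?w(l := a l - d l)" "?w(l := a l) = ?w"
    using insert.hyps(2) l by (auto simp: perturb_def fun_eq_iff)
  have "F ((perturb a d (insert l K))(i := d i)) = F ?w - F (?w(l := d l))"
    using F_diff[OF l(1) a[OF l(1)] d[OF l(1)], of ?w] unfolding upd by simp
  moreover have "\<bar>F (?w(l := d l))\<bar> \<le> \<epsilon>\<^sup>2 * majorant a \<epsilon>"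
    using two_perturbations_le[OF \<open>i \<in> J\<close> l(1)] l(2) by simp
  ultimately show ?case
    using insert by (simp add: algebra_simps del: fun_upd_apply)
qed

text \<open>Adding \<open>l\<close> to \<open>K\<close> subtracts \<open>F\<close> with
  \<open>d l\<close> at \<open>l\<close> and the remaining arguments partly perturbed. The new
  summand \<open>F (a(l := d l))\<close> cancels this up to \<open>card K\<close> second order
  terms, so the total count grows quadratically.\<close>

lemma second_order_remainder_le:
  "\<bar>F (\<lambda>j. if j \<in> J then a j - d j else a j) - F a + (\<Sum>i\<in>J. F (a(i := d i)))\<bar> \<le>
    (real (card J))\<^sup>2 * \<epsilon>\<^sup>2 * majorant a \<epsilon>"
proof -
  have main: "\<bar>F (perturb a d K) - F a + (\<Sum>i\<in>K. F (a(i := d i)))\<bar> \<le>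
      (real (card K))\<^sup>2 * \<epsilon>\<^sup>2 * majorant a \<epsilon>"
    if "finite K" "K \<subseteq> J" for K
    using that
  proof (induction K)
    case empty
    then show ?case
      by (simp add: perturb_def)
  next
    case (insert l K)
    let ?p = "perturb a d K"
    have l: "l \<in> J"
      using insert by auto
    have upd: "perturb a d (insert l K) = ?p(l := a l - d l)" "?p(l := a l) = ?p"
      using insert.hyps(2) by (auto simp: perturb_def fun_eq_iff)
    have "F (perturb a d (insert l K)) = F ?p - F (?p(l := d l))"
      using F_diff[OF l a[OF l] d[OF l], of ?p] unfolding upd by simp
    moreover have "\<bar>F (?p(l := d l)) - F (a(l := d l))\<bar> \<le> real (card K) * \<epsilon>\<^sup>2 * majorant a \<epsilon>"
      using one_perturbation_diff_le[of K l] insert by auto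
    moreover have "\<bar>F ?p - F a + (\<Sum>i\<in>K. F (a(i := d i)))\<bar> \<le> (real (card K))\<^sup>2 * \<epsilon>\<^sup>2 * majorant a \<epsilon>"
      using insert by blast
    ultimately have "\<bar>F (perturb a d (insert l K)) - F a + (\<Sum>i\<in>insert l K. F (a(i := d i)))\<bar> \<le>
        ((real (card K))\<^sup>2 + real (card K)) * (\<epsilon>\<^sup>2 * majorant a \<epsilon>)"
      using insert.hyps by (simp add: algebra_simps)
    \<comment> \<open>With \<open>k = card K\<close>, this is
      \<open>k * k + k \<le> (k + 1) * (k + 1)\<close>.\<close>
    also have "\<dots> \<le> (real (card (insert l K)))\<^sup>2 * (\<epsilon>\<^sup>2 * majorant a \<epsilon>)"
      using insert.hyps majorant_nonneg by (intro mult_right_mono mult_nonneg_nonneg)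
        (auto simp: power2_eq_square algebra_simps)
    finally show ?case
      by (simp add: mult_ac del: fun_upd_apply)
  qed
  show ?thesis
    using main[OF finite_J] by (simp add: perturb_def[abs_def])
qed

end

end

text \<open>The vector \<open>u\<close> in mode \<open>m\<close> has norm 1, so it drops out of the
  product of norms.\<close>

lemma bounded_multilinear_form_contract_modes:
  assumes "finite I" "m \<in> I" and s: "\<And>j. j \<in> I \<Longrightarrow> 0 < s j"
    and u: "u \<in> carrier_vec (s m)" "l2norm u = 1"
  shows "bounded_multilinear_form (I - {m}) s
    (\<lambda>w. contract_modes I (w(m := u)) T (\<lambda>_. undefined)) (spectral_norm s I T)"
proof
  fix j and v v' :: "real vec" and w :: "nat \<Rightarrow> real vec"
  assume j: "j \<in> I - {m}" and v: "v \<in> carrier_vec (s j)" "v' \<in> carrier_vec (s j)"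
  have "(w(j := z))(m := u) = (w(m := u))(j := z)" for z
    using j by auto
  then show "contract_modes I ((w(j := v - v'))(m := u)) T (\<lambda>_. undefined) =
      contract_modes I ((w(j := v))(m := u)) T (\<lambda>_. undefined) -
      contract_modes I ((w(j := v'))(m := u)) T (\<lambda>_. undefined)"
    using contract_modes_diff_vec[of I j v v' "w(m := u)" T] assms(1) j v by simp
next
  fix w :: "nat \<Rightarrow> real vec"
  assume w: "\<And>j. j \<in> I - {m} \<Longrightarrow> w j \<in> carrier_vec (s j)"
  have "(\<Prod>j\<in>I. l2norm ((w(m := u)) j)) = (\<Prod>j\<in>I - {m}. l2norm (w j))"
    using assms(1,2) u by (simp add: prod.remove)
  then show "\<bar>contract_modes I (w(m := u)) T (\<lambda>_. undefined)\<bar> \<le>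
      spectral_norm s I T * (\<Prod>j\<in>I - {m}. l2norm (w j))"
    using contract_modes_le_spectral_norm[of I s "w(m := u)" T] assms w
    by (metis DiffI empty_iff fun_upd_apply singletonD)
qed (use assms spectral_norm_nonneg in auto)

section \<open>The error of the pairwise perturbation update\<close>

lemma pp_update_error_le:
  fixes N :: nat and T P :: tensor
  assumes mn: "m < N" "n < N" "m \<noteq> n" and s: "\<And>l. l < N \<Longrightarrow> 0 < s l"
    and a: "\<And>l. l < N \<Longrightarrow> a l \<in> carrier_vec (s l)"
    and d: "\<And>l. l < N \<Longrightarrow> d l \<in> carrier_vec (s l)"
    and d_le: "\<And>l. l < N \<Longrightarrow> l2norm (d l) \<le> \<epsilon> * l2norm (a l)"
    and eps: "0 \<le> \<epsilon>" "real N * \<epsilon> \<le> 1"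
  defines "I \<equiv> {..<N} - {n}" and "J \<equiv> {..<N} - {m, n}"
  shows "l2norm (pp_update_col N s T P a d m n - exact_update_col N s T a m n) \<le>
    (real N * \<epsilon>) * spectral_norm s I (\<lambda>i. P i - T i) * (\<Prod>j\<in>J. l2norm (a j)) +
    3 * (real N * \<epsilon>)\<^sup>2 * spectral_norm s I T * (\<Prod>j\<in>J. l2norm (a j))"
proof -
  let ?e = "pp_update_col N s T P a d m n - exact_update_col N s T a m n"
  let ?p = "\<Prod>j\<in>J. l2norm (a j)"
  have I: "finite I" "m \<in> I" "I - {m} = J" "\<And>j. j \<in> I \<Longrightarrow> 0 < s j" and J: "finite J" "m \<notin> J" "J \<subseteq> {..<N}"
    using mn s by (auto simp: I_def J_def)
  \<comment> \<open>This is the argument family in \<open>second_order_remainder_le\<close>; only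
    its values on \<open>J\<close> enter the contraction.\<close>
  define a' where "a' = (\<lambda>j. if j \<in> J then a j - d j else a j)"
  define E where "E = (\<lambda>i. contract_modes J a' T i + (\<Sum>l\<in>J. contract_modes J (a(l := d l)) P i)
      - contract_modes J a T i)"
  have "contract_modes J (\<lambda>j. a j - d j) T = contract_modes J a' T"
    using J(1) by (rule contract_modes_cong) (simp add: a'_def)
  moreover have "contract_modes ({..<N} - {m, n, l}) a (contract P l (d l)) =
      contract_modes J (a(l := d l)) P" if "l \<in> J" for l
  proof -
    have "{..<N} - {m, n, l} = J - {l}"
      by (auto simp: J_def)
    then show ?thesis
      using contract_modes_fun_upd[OF J(1) that, of a "d l" P]
      by (simp add: contract_modes_contract)
  qed
  ultimately have e: "?e = mode_vec s m E"
    unfolding pp_update_col_def exact_update_col_def J_def[symmetric]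
    by (intro eq_vecI) (auto simp: mode_vec_def E_def)
  have "?e \<in> carrier_vec (s m)"
    by (simp add: e mode_vec_def)
  then obtain u where u: "u \<in> carrier_vec (s m)" "l2norm u = 1" "?e = l2norm ?e \<cdot>\<^sub>v u"
    using unit_direction s[OF mn(1)] by blast
  define F where "F = (\<lambda>Y w. contract_modes I (w(m := u)) Y (\<lambda>_. undefined))"
  have F: "F Y w = contract (contract_modes J w Y) m u (\<lambda>_. undefined)" for Y w
    using contract_modes_fun_upd[OF I(1,2), of w u Y] I(3) by (simp add: F_def)
  interpret T: bounded_multilinear_form J s "F T" "spectral_norm s I T"
    using bounded_multilinear_form_contract_modes[where u = u and m = m and s = s,
        OF I(1,2,4) u(1,2), of T]
    by (simp add: F_def I(3))
  interpret PT: bounded_multilinear_form J s "F (\<lambda>i. P i - T i)" "spectral_norm s I (\<lambda>i. P i - T i)"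
    using bounded_multilinear_form_contract_modes[where u = u and m = m and s = s,
        OF I(1,2,4) u(1,2), of "\<lambda>i. P i - T i"]
    by (simp add: F_def I(3))
  \<comment> \<open>Pairing with its own direction \<open>u\<close> turns the norm of the error into
    a linear expression, also when the error is zero.\<close>
  have "l2norm ?e = l2norm ?e * (u \<bullet> u)"
    by (simp add: scalar_prod_self u(2))
  also have "\<dots> = ?e \<bullet> u"
    using arg_cong[OF u(3), of "\<lambda>v. v \<bullet> u"] u(1) by simp
  also have "\<dots> = contract E m u (\<lambda>_. undefined)"
    unfolding e by (rule scalar_prod_mode_vec[where m = m and s = s, OF u(1)])
  also have "\<dots> = F T a' + (\<Sum>l\<in>J. F P (a(l := d l))) - F T a"
    by (simp add: E_def F contract_diff contract_add contract_sum)
  \<comment> \<open>Splitting \<open>P\<close> as \<open>T + (P - T)\<close> in the correction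
    terms: the \<open>T\<close> part cancels the first order error, the rest stays first order but
    involves only \<open>P - T\<close>.\<close>
  also have "\<dots> = (F T a' - F T a + (\<Sum>l\<in>J. F T (a(l := d l)))) +
      (\<Sum>l\<in>J. F (\<lambda>i. P i - T i) (a(l := d l)))"
    by (simp add: F contract_modes_diff contract_diff sum_subtractf)
  finally have split: "l2norm ?e \<le> \<bar>F T a' - F T a + (\<Sum>l\<in>J. F T (a(l := d l)))\<bar> +
      \<bar>\<Sum>l\<in>J. F (\<lambda>i. P i - T i) (a(l := d l))\<bar>"
    by linarith
  have loc: "\<And>j. j \<in> J \<Longrightarrow> a j \<in> carrier_vec (s j)" "\<And>j. j \<in> J \<Longrightarrow> d j \<in> carrier_vec (s j)"
    "\<And>j. j \<in> J \<Longrightarrow> l2norm (d j) \<le> \<epsilon> * l2norm (a j)"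
    using J(3) a d d_le by auto
  have card: "real (card J) \<le> real N"
    using card_mono[OF _ J(3)] by simp
  \<comment> \<open>Origin of the constant 3: the power is at most
    \<open>exp (N * \<epsilon>)\<close>, hence at most \<open>exp 1\<close>.\<close>
  have "(1 + \<epsilon>) ^ card J \<le> exp \<epsilon> ^ card J"
    using eps by (intro power_mono exp_ge_add_one_self) auto
  also have "\<dots> = exp (real (card J) * \<epsilon>)"
    by (simp add: exp_of_nat_mult)
  also have "\<dots> \<le> exp 1"
    using mult_right_mono[OF card eps(1)] eps(2) by simp
  also have "\<dots> \<le> 3"
    by (rule exp_le)
  finally have pow: "(1 + \<epsilon>) ^ card J \<le> 3" .
  have p: "0 \<le> ?p"
    by (simp add: prod_nonneg)
  have "\<bar>F T a' - F T a + (\<Sum>l\<in>J. F T (a(l := d l)))\<bar> \<le>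
      (real (card J))\<^sup>2 * \<epsilon>\<^sup>2 * T.majorant a \<epsilon>"
    unfolding a'_def by (rule T.second_order_remainder_le[OF loc eps(1)])
  also have "\<dots> \<le> (real N)\<^sup>2 * \<epsilon>\<^sup>2 * (spectral_norm s I T * 3 * ?p)"
    unfolding T.majorant_def using card pow p T.S_nonneg eps
    by (intro mult_mono power_mono) auto
  finally have second: "\<bar>F T a' - F T a + (\<Sum>l\<in>J. F T (a(l := d l)))\<bar> \<le>
      3 * (real N * \<epsilon>)\<^sup>2 * spectral_norm s I T * ?p"
    by (simp add: power_mult_distrib mult_ac)
  have "\<bar>\<Sum>l\<in>J. F (\<lambda>i. P i - T i) (a(l := d l))\<bar> \<le>
      (\<Sum>l\<in>J. \<epsilon> * spectral_norm s I (\<lambda>i. P i - T i) * ?p)"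
    by (rule order_trans[OF sum_abs], rule sum_mono, rule PT.first_order_le[OF loc eps(1)])
  also have "\<dots> = real (card J) * (\<epsilon> * spectral_norm s I (\<lambda>i. P i - T i) * ?p)"
    by simp
  also have "\<dots> \<le> real N * (\<epsilon> * spectral_norm s I (\<lambda>i. P i - T i) * ?p)"
    using card p PT.S_nonneg eps by (intro mult_right_mono) auto
  finally show ?thesis
    using split second by (simp add: mult_ac)
qed

text \<open>The witnesses are \<open>C = 3\<close> and \<open>c = 1\<close>; one constant covers the
  coefficients 1 and 3 of the two error terms.\<close>

theorem theorem4p3:
  shows "\<exists>C>0. \<exists>c>0.
    \<forall>(N::nat) (s::nat \<Rightarrow> nat) (R::nat) (X::tensor)
      (Ap::nat \<Rightarrow> real mat) (dA::nat \<Rightarrow> real mat) (A::nat \<Rightarrow> real mat)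
      (dltA::nat \<Rightarrow> real mat) (ns::nat list) (k::nat) (\<epsilon>::real).
      (\<forall>l<N. 0 < s l) \<and>
      (\<forall>l<N. Ap l \<in> carrier_mat (s l) R \<and> dA l \<in> carrier_mat (s l) R \<and> A l = Ap l + dA l) \<and>
      distinct ns \<and> set ns = {..<N} \<and>
      (\<forall>n<N. dltA n = als_sweep N s R X ns A n - A n) \<and>
      k < R \<and> \<epsilon> < 1 \<and>
      (\<forall>l<N. col (A l) k \<noteq> 0\<^sub>v (s l) \<and>
        l2norm (col (dA l) k) / l2norm (col (A l) k) \<le> \<epsilon>) \<and>
      real N * \<epsilon> \<le> c
      \<longrightarrow>
      (\<forall>m<N. \<forall>n<N. m \<noteq> n \<longrightarrow>
        (let a = (\<lambda>j. col (A j) k);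
             da = (\<lambda>j. col (dA j) k);
             That = contract X n (col (dltA n) k);
             Phat = contract (cp_tensor N R A) n (col (dltA n) k);
             h = exact_update_col N s That a m n;
             h' = pp_update_col N s That Phat a da m n;
             p = (\<Prod>j\<in>{..<N} - {m, n}. l2norm (a j))
         in l2norm (h' - h)
              \<le> C * (real N * \<epsilon>) * spectral_norm s ({..<N} - {n}) (\<lambda>i. Phat i - That i) * p
                + C * (real N * \<epsilon>)\<^sup>2 * spectral_norm s ({..<N} - {n}) That * p))"
proof (rule exI[of _ "3::real"], rule conjI, simp, rule exI[of _ "1::real"],
    intro conjI allI impI, simp, goal_cases)
  case (1 N s R X Ap dA A dltA ns k \<epsilon> m n)
  let ?a = "\<lambda>j. col (A j) k" and ?d = "\<lambda>j. col (dA j) k"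
  let ?T = "contract X n (col (dltA n) k)"
  let ?P = "contract (cp_tensor N R A) n (col (dltA n) k)"
  let ?I = "{..<N} - {n}" and ?J = "{..<N} - {m, n}"
  let ?S = "spectral_norm s ?I (\<lambda>i. ?P i - ?T i)" and ?p = "\<Prod>j\<in>?J. l2norm (?a j)"
  have s: "\<And>l. l < N \<Longrightarrow> 0 < s l" and mn: "m < N" "n < N" "m \<noteq> n"
    using 1 by auto
  have carrier: "A l \<in> carrier_mat (s l) R" "dA l \<in> carrier_mat (s l) R" if "l < N" for l
    using 1 that by auto
  have a: "?a l \<in> carrier_vec (s l)" if "l < N" for l
    using carrier(1)[OF that] by (metis carrier_matD(1) col_dim)
  have d: "?d l \<in> carrier_vec (s l)" if "l < N" for l
    using carrier(2)[OF that] by (metis carrier_matD(1) col_dim)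
  have ratio: "0 < l2norm (?a l)" "l2norm (?d l) / l2norm (?a l) \<le> \<epsilon>" if "l < N" for l
  proof -
    have "?a l \<noteq> 0\<^sub>v (s l)"
      using 1 that by blast
    then have "l2norm (?a l) \<noteq> 0"
      using carrier_vecD[OF a[OF that]] l2norm_eq_0_iff[of "?a l"] by metis
    then show "0 < l2norm (?a l)"
      using l2norm_nonneg[of "?a l"] by linarith
    show "l2norm (?d l) / l2norm (?a l) \<le> \<epsilon>"
      using 1 that by blast
  qed
  have d_le: "l2norm (?d l) \<le> \<epsilon> * l2norm (?a l)" if "l < N" for l
    using ratio[OF that] by (simp add: divide_le_eq)
  \<comment> \<open>Nonnegativity of \<open>\<epsilon>\<close> is not assumed; it follows because
    \<open>\<epsilon>\<close> bounds a ratio of norms at mode \<open>m\<close>.\<close>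
  have "0 \<le> l2norm (?d m) / l2norm (?a m)"
    by simp
  then have eps: "0 \<le> \<epsilon>" "real N * \<epsilon> \<le> 1"
    using ratio(2)[OF mn(1)] 1 by (linarith, blast)
  have "0 \<le> ?S"
    by (rule spectral_norm_nonneg) (use s in blast)+
  moreover have "0 \<le> ?p"
    by (simp add: prod_nonneg)
  ultimately have "(real N * \<epsilon>) * ?S * ?p \<le> 3 * (real N * \<epsilon>) * ?S * ?p"
    using eps by (intro mult_right_mono) auto
  then show ?case
    unfolding Let_def
    using pp_update_error_le[where s = s and a = ?a and d = ?d and T = ?T and P = ?P,
        OF mn s a d d_le eps] by linarith
qed

end
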